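(* Let $X$ be a Banach space. The following are equivalent: (1) There exists a $\|\cdot\|$-$w^*$ continuous dual map on $X$. (2) $X$ is smooth.
   Context: Banach spaces are over $\mathbb{R}$ or $\mathbb{C}$; $\mathsf{B}_X$ and $\mathsf{S}_X$ denote the closed unit ball and the unit sphere of $X$, and $X^*$ is the (continuous) dual. A map $T : X \to X^*$ (not assumed linear, homogeneous or continuous) is called a dual map on $X$ if $\|T(x)\| = \|x\|$ and $T(x)(x) = \|x\|^2$ for all $x \in X$. A point $x \in \mathsf{S}_X$ is a smooth point of $\mathsf{B}_X$ if there is exactly one $f \in \mathsf{S}_{X^*}$ attaining its norm at $x$, i.e. with $f(x) = 1$. $X$ is smooth if every point of $\mathsf{S}_X$ is a smooth point of $\mathsf{B}_X$. "$\|\cdot\|$-$w^*$ continuous" means continuous from $X$ with the norm topology to $X^*$ with the weak-star topology. *)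

theory Defs
  imports "HOL-Analysis.Analysis"
begin

text \<open>
  The definitions are generic in the scalar field \<open>'k\<close>, and are used for \<open>'k = real\<close> with
  \<open>smul = scaleR\<close> and for \<open>'k = complex\<close> with a complex scalar multiplication on \<open>'a\<close>.
  The locale describes a scalar multiplication that is compatible with the norm and
  extends the real scalar multiplication of the underlying real Banach space \<open>'a\<close>.
\<close>

locale banach_space_over = vector_space smul
  for smul :: "'k::real_normed_field \<Rightarrow> 'a::banach \<Rightarrow> 'a" +
  assumes norm_smul: "norm (smul c x) = norm c * norm x"
    and smul_of_real: "smul (of_real r) x = r *\<^sub>R x"

text \<open>
  Elements of \<^typ>\<open>'a \<Rightarrow>\<^sub>L 'k\<close> are bounded and only real-linear, so \<open>'k\<close>-homogeneity is
  required in addition. The norm of \<^typ>\<open>'a \<Rightarrow>\<^sub>L 'k\<close> is the usual dual norm.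
\<close>

definition dual_space ::
    "('k::real_normed_field \<Rightarrow> 'a::banach \<Rightarrow> 'a) \<Rightarrow> ('a \<Rightarrow>\<^sub>L 'k) set" where
  "dual_space smul = {f. \<forall>c x. blinfun_apply f (smul c x) = c * blinfun_apply f x}"

text \<open>For scalar-valued maps the strong operator topology is that of pointwise convergence.\<close>

definition weak_star_topology ::
    "('k::real_normed_field \<Rightarrow> 'a::banach \<Rightarrow> 'a) \<Rightarrow> ('a \<Rightarrow>\<^sub>L 'k) topology" where
  "weak_star_topology smul = subtopology strong_operator_topology (dual_space smul)"

definition dual_map ::
    "('k::real_normed_field \<Rightarrow> 'a::banach \<Rightarrow> 'a) \<Rightarrow> ('a \<Rightarrow> ('a \<Rightarrow>\<^sub>L 'k)) \<Rightarrow> bool" where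
  "dual_map smul T \<longleftrightarrow>
     (\<forall>x. T x \<in> dual_space smul \<and> norm (T x) = norm x \<and>
          blinfun_apply (T x) x = of_real ((norm x)\<^sup>2))"

definition smooth_point ::
    "('k::real_normed_field \<Rightarrow> 'a::banach \<Rightarrow> 'a) \<Rightarrow> 'a \<Rightarrow> bool" where
  "smooth_point smul x \<longleftrightarrow>
     x \<in> sphere 0 1 \<and> (\<exists>!f. f \<in> dual_space smul \<and> norm f = 1 \<and> blinfun_apply f x = 1)"

definition smooth_space ::
    "('k::real_normed_field \<Rightarrow> 'a::banach \<Rightarrow> 'a) \<Rightarrow> bool" where
  "smooth_space smul \<longleftrightarrow> (\<forall>x\<in>sphere 0 1. smooth_point smul x)"

end

theory Submission
  imports Defs
begin

text \<open>
  Suppose that \<open>T\<close> is a real dual map, \<open>\<parallel>x\<parallel> = 1\<close>, and \<open>f\<close> is a real functional of norm at most 1 with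
  \<open>f x = 1\<close>. Both \<open>f\<close> and \<open>T (x + t *\<^sub>R y)\<close> are subgradients of the norm, up to the factor
  \<open>\<parallel>x + t *\<^sub>R y\<parallel>\<close> in the second case: the first at \<open>x\<close>, the second at \<open>x + t *\<^sub>R y\<close>. By monotonicity of
  subgradients, \<open>\<parallel>x + t *\<^sub>R y\<parallel> * f y \<le> T (x + t *\<^sub>R y) y\<close> for \<open>t > 0\<close>, so that weak-star continuity of \<open>T\<close>
  gives \<open>f y \<le> T x y\<close> as \<open>t\<close> tends to 0, and equality on replacing \<open>y\<close> by \<open>- y\<close>
  (\<open>support_functional_eq_limit\<close>). Hence \<open>T x\<close> is the only support functional at \<open>x\<close>. Over the complex
  numbers the argument applies to real parts, and a complex-linear functional is determined by its
  real part.

  Conversely, smoothness provides at every \<open>x\<close> exactly one functional \<open>f\<close> with \<open>\<parallel>f\<parallel> = \<parallel>x\<parallel>\<close> and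
  \<open>f x = \<parallel>x\<parallel>\<^sup>2\<close>, and therefore exactly one dual map \<open>T\<close>. When \<open>z\<close> tends to \<open>x\<close>, the functionals
  \<open>T z\<close> eventually lie in a product of closed balls, which is compact by Tychonoff's theorem. Every
  cluster point of them is again a functional of this kind at \<open>x\<close> (\<open>cluster_point_of_dual_map\<close>), hence
  equal to \<open>T x\<close>. In a compact set a unique cluster point is a limit, so \<open>T\<close> is continuous.
\<close>

section \<open>Dual maps and pointwise continuity\<close>

lemma continuous_weak_star_iff:
  assumes "dual_map smul T"
  shows "continuous_map euclidean (weak_star_topology smul) T
           \<longleftrightarrow> (\<forall>y. continuous_on UNIV (\<lambda>z. blinfun_apply (T z) y))"
proof -
  have "range T \<subseteq> dual_space smul"
    using assms by (auto simp: dual_map_def)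
  then show ?thesis
    by (simp add: weak_star_topology_def continuous_map_in_subtopology
        continuous_on_strong_operator_topo_iff_coordinatewise image_subset_iff Pi_iff)
qed

section \<open>A continuous dual map forces smoothness\<close>

text \<open>
  With \<open>n = \<parallel>x + t *\<^sub>R y\<parallel>\<close> and \<open>g\<close> in the role of the value of a dual map at \<open>x + t *\<^sub>R y\<close>, this is
  the sum of \<open>n * f (x + t *\<^sub>R y) \<le> n * n\<close> and \<open>g x \<le> n\<close>, divided by \<open>t\<close>.
\<close>

lemma support_functional_monotone:
  fixes f g :: "'a::real_normed_vector \<Rightarrow>\<^sub>L real"
  assumes x: "norm x = 1" and f: "norm f \<le> 1" "blinfun_apply f x = 1"
    and t: "t > 0"
    and g: "norm g \<le> norm (x + t *\<^sub>R y)"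
      "blinfun_apply g (x + t *\<^sub>R y) = (norm (x + t *\<^sub>R y))\<^sup>2"
  shows "norm (x + t *\<^sub>R y) * blinfun_apply f y \<le> blinfun_apply g y"
proof -
  define n where "n = norm (x + t *\<^sub>R y)"
  have n0: "n \<ge> 0" by (simp add: n_def)
  have "blinfun_apply f (x + t *\<^sub>R y) \<le> norm f * n"
    using norm_blinfun[of f "x + t *\<^sub>R y"] by (simp add: n_def)
  also have "\<dots> \<le> n"
    using f(1) n0 by (simp add: mult_left_le_one_le)
  finally have a: "t * blinfun_apply f y \<le> n - 1"
    using f(2) by (simp add: blinfun.add_right blinfun.scaleR_right)
  have "blinfun_apply g x \<le> n"
    using norm_blinfun[of g x] g(1) x by (simp add: n_def)
  moreover have "blinfun_apply g x + t * blinfun_apply g y = n\<^sup>2"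
    using g(2) by (simp add: n_def blinfun.add_right blinfun.scaleR_right)
  ultimately have "n * (n - 1) \<le> t * blinfun_apply g y"
    by (simp add: power2_eq_square algebra_simps)
  moreover have "n * (t * blinfun_apply f y) \<le> n * (n - 1)"
    using a n0 by (rule mult_left_mono)
  ultimately have "t * (n * blinfun_apply f y) \<le> t * blinfun_apply g y"
    by (simp add: mult.left_commute)
  then show ?thesis
    using t by (simp add: n_def)
qed

lemma support_functional_eq_limit:
  fixes T :: "'a::real_normed_vector \<Rightarrow> ('a \<Rightarrow>\<^sub>L real)"
  assumes T: "\<And>z. norm (T z) \<le> norm z" "\<And>z. blinfun_apply (T z) z = (norm z)\<^sup>2"
    and cont: "\<And>y. isCont (\<lambda>z. blinfun_apply (T z) y) x"
    and x: "norm x = 1" and f: "norm f \<le> 1" "blinfun_apply f x = 1"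
  shows "f = T x"
proof -
  have le: "blinfun_apply f y \<le> blinfun_apply (T x) y" for y
  proof (rule tendsto_le)
    have line: "((\<lambda>t. x + t *\<^sub>R y) \<longlongrightarrow> x) (at_right 0)"
      by (auto intro!: tendsto_eq_intros)
    show "((\<lambda>t. blinfun_apply (T (x + t *\<^sub>R y)) y) \<longlongrightarrow> blinfun_apply (T x) y) (at_right 0)"
      by (rule isCont_tendsto_compose[OF cont line])
    show "((\<lambda>t. norm (x + t *\<^sub>R y) * blinfun_apply f y) \<longlongrightarrow> blinfun_apply f y) (at_right 0)"
      using tendsto_mult[OF tendsto_norm[OF line] tendsto_const[of "blinfun_apply f y"]]
      by (simp add: x)
    show "\<forall>\<^sub>F t in at_right 0. norm (x + t *\<^sub>R y) * blinfun_apply f y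
            \<le> blinfun_apply (T (x + t *\<^sub>R y)) y"
      using eventually_at_right_less[of "0::real"]
      by eventually_elim (intro support_functional_monotone x f T)
  qed simp
  have "blinfun_apply f y = blinfun_apply (T x) y" for y
    using le[of y] le[of "- y"] by (simp add: blinfun.minus_right)
  then show ?thesis
    by (rule blinfun_eqI)
qed

lemma smooth_space_if_support_functional_unique:
  assumes T: "dual_map smul T"
    and unique: "\<And>x f. \<lbrakk>norm x = 1; f \<in> dual_space smul; norm f = 1; blinfun_apply f x = 1\<rbrakk>
                   \<Longrightarrow> f = T x"
  shows "smooth_space smul"
  unfolding smooth_space_def smooth_point_def
proof (intro ballI conjI ex1I)
  fix x :: 'b assume "x \<in> sphere 0 1"
  then have x: "norm x = 1" by simp
  show "T x \<in> dual_space smul" "norm (T x) = 1" "blinfun_apply (T x) x = 1"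
    using T x by (auto simp: dual_map_def)
  show "f = T x" if "f \<in> dual_space smul \<and> norm f = 1 \<and> blinfun_apply f x = 1" for f
    using unique x that by blast
qed auto

lemma real_smooth_if_continuous_dual_map:
  fixes T :: "'a::banach \<Rightarrow> ('a \<Rightarrow>\<^sub>L real)"
  assumes T: "dual_map scaleR T"
    and cont: "continuous_map euclidean (weak_star_topology scaleR) T"
  shows "smooth_space (scaleR :: real \<Rightarrow> 'a \<Rightarrow> 'a)"
proof (rule smooth_space_if_support_functional_unique[OF T])
  fix x :: 'a and f :: "'a \<Rightarrow>\<^sub>L real"
  assume "norm x = 1" "norm f = 1" "blinfun_apply f x = 1"
  moreover have "isCont (\<lambda>z. blinfun_apply (T z) y) x" for y
    using cont by (simp add: continuous_weak_star_iff[OF T] continuous_on_eq_continuous_at)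
  ultimately show "f = T x"
    using T by (intro support_functional_eq_limit) (auto simp: dual_map_def)
qed

definition Re_blinfun :: "('a::real_normed_vector \<Rightarrow>\<^sub>L complex) \<Rightarrow> ('a \<Rightarrow>\<^sub>L real)" where
  "Re_blinfun f = Blinfun Re o\<^sub>L f"

lemma Re_blinfun_apply [simp]: "blinfun_apply (Re_blinfun f) x = Re (blinfun_apply f x)"
  by (simp add: Re_blinfun_def bounded_linear_Blinfun_apply bounded_linear_Re)

lemma norm_Re_blinfun_le: "norm (Re_blinfun f) \<le> norm f"
proof (rule norm_blinfun_bound)
  show "norm (blinfun_apply (Re_blinfun f) x) \<le> norm f * norm x" for x
    using abs_Re_le_cmod[of "blinfun_apply f x"] norm_blinfun[of f x] by simp
qed simp

text \<open>The imaginary part of \<open>f y\<close> is recovered as the real part of \<open>- f (\<i> y)\<close>.\<close>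

lemma Re_blinfun_inject:
  assumes "f \<in> dual_space smul" "g \<in> dual_space smul" "Re_blinfun f = Re_blinfun g"
  shows "f = g"
proof (rule blinfun_eqI, rule complex_eqI)
  fix y
  have Re_eq: "Re (blinfun_apply f z) = Re (blinfun_apply g z)" for z
    using assms(3) by (metis Re_blinfun_apply)
  show "Re (blinfun_apply f y) = Re (blinfun_apply g y)"
    by (rule Re_eq)
  show "Im (blinfun_apply f y) = Im (blinfun_apply g y)"
    using Re_eq[of "smul \<i> y"] assms(1,2) by (simp add: dual_space_def)
qed

lemma complex_smooth_if_continuous_dual_map:
  fixes smul :: "complex \<Rightarrow> 'a::banach \<Rightarrow> 'a"
  assumes T: "dual_map smul T"
    and cont: "continuous_map euclidean (weak_star_topology smul) T"
  shows "smooth_space smul"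
proof (rule smooth_space_if_support_functional_unique[OF T])
  fix x :: 'a and f :: "'a \<Rightarrow>\<^sub>L complex"
  assume x: "norm x = 1" and f: "f \<in> dual_space smul" "norm f = 1" "blinfun_apply f x = 1"
  have "Re_blinfun f = Re_blinfun (T x)"
  proof (rule support_functional_eq_limit)
    show "norm (Re_blinfun (T z)) \<le> norm z" for z
      using norm_Re_blinfun_le[of "T z"] T by (simp add: dual_map_def)
    show "blinfun_apply (Re_blinfun (T z)) z = (norm z)\<^sup>2" for z
      using T by (simp add: dual_map_def del: of_real_power)
    have "isCont (\<lambda>z. blinfun_apply (T z) y) x" for y
      using cont by (simp add: continuous_weak_star_iff[OF T] continuous_on_eq_continuous_at)
    then show "isCont (\<lambda>z. blinfun_apply (Re_blinfun (T z)) y) x" for y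
      by simp
    show "norm (Re_blinfun f) \<le> 1" "blinfun_apply (Re_blinfun f) x = 1"
      using norm_Re_blinfun_le[of f] f by simp_all
  qed (fact x)
  moreover have "T x \<in> dual_space smul"
    using T by (simp add: dual_map_def)
  ultimately show "f = T x"
    using f(1) by (intro Re_blinfun_inject)
qed

section \<open>Unique cluster points in compact sets\<close>

text \<open>
  If \<open>f\<close> stayed outside a neighbourhood \<open>S\<close> of \<open>l\<close> frequently along \<open>F\<close>, the trace of \<open>F\<close> on
  \<open>{z. f z \<notin> S}\<close> would have a cluster point in \<open>K\<close>, and along a suitable finer filter \<open>f\<close> would tend to
  it. Stating the uniqueness hypothesis for filters finer than \<open>F\<close> lets it be checked with the usual
  limit calculus.
\<close>

lemma tendsto_if_unique_cluster_point:
  fixes f :: "'b \<Rightarrow> 'c::topological_space"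
  assumes K: "compact K" "\<forall>\<^sub>F z in F. f z \<in> K"
    and unique: "\<And>G g. \<lbrakk>G \<le> F; G \<noteq> bot; (f \<longlongrightarrow> g) G\<rbrakk> \<Longrightarrow> g = l"
  shows "(f \<longlongrightarrow> l) F"
proof (rule topological_tendstoI, rule ccontr)
  fix S assume S: "open S" "l \<in> S" and not_ev: "\<not> (\<forall>\<^sub>F z in F. f z \<in> S)"
  define F' where "F' = inf F (principal {z. f z \<notin> S})"
  have "F' \<noteq> bot"
    using not_ev by (simp add: F'_def trivial_limit_def eventually_inf_principal)
  then have "filtermap f F' \<noteq> bot"
    by (simp add: filtermap_bot_iff)
  moreover have "\<forall>\<^sub>F h in filtermap f F'. h \<in> K"
    using K(2) by (auto simp: eventually_filtermap F'_def eventually_inf_principal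
        elim: eventually_mono)
  ultimately obtain g where g: "inf (nhds g) (filtermap f F') \<noteq> bot"
    using K(1)[unfolded compact_filter, rule_format] by blast
  define G where "G = inf F' (filtercomap f (nhds g))"
  have "G \<noteq> bot"
  proof
    assume "G = bot"
    then obtain P Q where P: "eventually P F'" and Q: "eventually Q (nhds g)"
      and PQ: "\<And>z. P z \<Longrightarrow> \<not> Q (f z)"
      unfolding G_def trivial_limit_def eventually_inf eventually_filtercomap by blast
    have "\<forall>\<^sub>F z in F'. \<not> Q (f z)"
      using P PQ by (auto elim: eventually_mono)
    then have "inf (nhds g) (filtermap f F') = bot"
      unfolding trivial_limit_def eventually_inf using Q
      by (intro exI[of _ Q] exI[of _ "\<lambda>h. \<not> Q h"]) (simp add: eventually_filtermap)
    with g show False by contradiction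
  qed
  moreover have "G \<le> F"
    by (simp add: G_def F'_def le_infI1)
  moreover have lim: "(f \<longlongrightarrow> g) G"
    unfolding filterlim_iff_le_filtercomap by (simp add: G_def)
  ultimately have "g = l"
    by (intro unique)
  then have "\<forall>\<^sub>F z in G. f z \<in> S"
    using topological_tendstoD[OF lim] S by blast
  moreover have "\<forall>\<^sub>F z in G. f z \<notin> S"
  proof -
    have "G \<le> principal {z. f z \<notin> S}"
      by (simp add: G_def F'_def le_infI1)
    then show ?thesis
      by (simp add: le_principal)
  qed
  ultimately have "\<forall>\<^sub>F z in G. False"
    by eventually_elim simp
  with \<open>G \<noteq> bot\<close> show False
    by (simp add: trivial_limit_def)
qed

lemma compact_pointwise_bounded_functions:
  fixes B :: "'i \<Rightarrow> real"
  shows "compact {h :: 'i \<Rightarrow> 'k::{real_normed_field, heine_borel}. \<forall>u. norm (h u) \<le> B u}"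
proof -
  have "compactin (product_topology (\<lambda>_. euclidean) UNIV) (\<Pi>\<^sub>E u\<in>UNIV. cball (0::'k) (B u))"
    by (simp add: compactin_PiE)
  moreover have "(\<Pi>\<^sub>E u\<in>UNIV. cball (0::'k) (B u)) = {h. \<forall>u. norm (h u) \<le> B u}"
    by (auto simp: PiE_def Pi_def)
  ultimately show ?thesis
    by (simp add: euclidean_product_topology)
qed

lemma tendsto_fun_apply:
  assumes "(f \<longlongrightarrow> g) F"
  shows "((\<lambda>z. f z u) \<longlongrightarrow> g u) F"
proof (rule topological_tendstoI)
  fix S assume "open S" "g u \<in> S"
  have "open ((\<lambda>h. h u) -` S)"
    using \<open>open S\<close> continuous_on_product_coordinates by (rule open_vimage)
  then show "\<forall>\<^sub>F z in F. f z u \<in> S"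
    using topological_tendstoD[OF assms] \<open>g u \<in> S\<close> by fastforce
qed

section \<open>Smoothness yields a continuous dual map\<close>

text \<open>Smoothness concerns unit vectors; the passage to all vectors is by scaling.\<close>

lemma smooth_space_unique_dual_functional:
  fixes smul :: "'k::real_normed_field \<Rightarrow> 'a::banach \<Rightarrow> 'a"
  assumes "smooth_space smul"
  shows "\<exists>!f. f \<in> dual_space smul \<and> norm f = norm x \<and> blinfun_apply f x = of_real ((norm x)\<^sup>2)"
proof (cases "x = 0")
  case True
  then show ?thesis
    by (auto simp: dual_space_def)
next
  case False
  define u where "u = x /\<^sub>R norm x"
  have x: "x = norm x *\<^sub>R u" and u: "u \<in> sphere 0 1"
    using False by (simp_all add: u_def)
  have scale: "r *\<^sub>R f \<in> dual_space smul" if "f \<in> dual_space smul" for r f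
    using that by (simp add: dual_space_def blinfun.scaleR_left)
  from assms u have "\<exists>!f. f \<in> dual_space smul \<and> norm f = 1 \<and> blinfun_apply f u = 1"
    by (simp add: smooth_space_def smooth_point_def)
  then obtain f where f: "f \<in> dual_space smul" "norm f = 1" "blinfun_apply f u = 1"
    and unique: "\<And>g. g \<in> dual_space smul \<Longrightarrow> norm g = 1 \<Longrightarrow> blinfun_apply g u = 1 \<Longrightarrow> g = f"
    by (elim ex1E) blast
  show ?thesis
  proof (intro ex1I conjI)
    show "norm x *\<^sub>R f \<in> dual_space smul"
      using f(1) by (rule scale)
    show "norm (norm x *\<^sub>R f) = norm x"
      by (simp add: f(2))
    have "blinfun_apply f x = of_real (norm x)"
      by (subst x) (simp add: blinfun.scaleR_right f(3) of_real_def)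
    then show "blinfun_apply (norm x *\<^sub>R f) x = of_real ((norm x)\<^sup>2)"
      by (simp add: blinfun.scaleR_left scaleR_conv_of_real power2_eq_square)
  next
    fix g
    assume g: "g \<in> dual_space smul \<and> norm g = norm x \<and> blinfun_apply g x = of_real ((norm x)\<^sup>2)"
    have "g /\<^sub>R norm x = f"
    proof (rule unique)
      show "g /\<^sub>R norm x \<in> dual_space smul"
        using g scale by blast
      show "norm (g /\<^sub>R norm x) = 1"
        using g False by simp
      show "blinfun_apply (g /\<^sub>R norm x) u = 1"
        using g False
        by (simp add: u_def blinfun.scaleR_left blinfun.scaleR_right scaleR_conv_of_real
            power2_eq_square field_simps)
    qed
    then show "g = norm x *\<^sub>R f"
      using False by auto
  qed
qed

text \<open>
  The defining properties of a dual map pass to pointwise limits: linearity and the bound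
  \<open>\<parallel>g\<parallel> \<le> \<parallel>x\<parallel>\<close> because they are closed conditions, and the value at \<open>x\<close> because
  \<open>T z x\<close> differs from \<open>T z z = \<parallel>z\<parallel>\<^sup>2\<close> by at most \<open>\<parallel>z\<parallel> * \<parallel>z - x\<parallel>\<close>. That value in turn forces
  \<open>\<parallel>g\<parallel> \<ge> \<parallel>x\<parallel>\<close>.
\<close>

lemma cluster_point_of_dual_map:
  fixes smul :: "'k::real_normed_field \<Rightarrow> 'a::banach \<Rightarrow> 'a"
  assumes T: "dual_map smul T"
    and G: "G \<le> nhds x" "G \<noteq> bot"
    and lim: "\<And>u. ((\<lambda>z. blinfun_apply (T z) u) \<longlongrightarrow> g u) G"
  obtains f where "f \<in> dual_space smul" "norm f = norm x"
    "blinfun_apply f x = of_real ((norm x)\<^sup>2)" "blinfun_apply f = g"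
proof -
  have T_dual: "T z \<in> dual_space smul" and T_norm: "norm (T z) = norm z"
    and T_self: "blinfun_apply (T z) z = of_real ((norm z)\<^sup>2)" for z
    using T by (auto simp: dual_map_def)
  have id_lim: "((\<lambda>z. z) \<longlongrightarrow> x) G"
    using G(1) by (simp add: filterlim_def filtermap_ident)
  have g_add: "g (u + v) = g u + g v" for u v
    using tendsto_unique[OF G(2) lim[of "u + v"]] tendsto_add[OF lim[of u] lim[of v]]
    by (simp add: blinfun.add_right)
  have g_scaleR: "g (r *\<^sub>R u) = r *\<^sub>R g u" for r u
    using tendsto_unique[OF G(2) lim[of "r *\<^sub>R u"]] tendsto_scaleR[OF tendsto_const lim[of u]]
    by (simp add: blinfun.scaleR_right)
  have g_smul: "g (smul c u) = c * g u" for c u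
    using tendsto_unique[OF G(2) lim[of "smul c u"]] tendsto_mult[OF tendsto_const lim[of u]] T_dual
    by (simp add: dual_space_def)
  have g_bound: "norm (g u) \<le> norm x * norm u" for u
  proof (rule tendsto_le[OF G(2)])
    show "((\<lambda>z. norm z * norm u) \<longlongrightarrow> norm x * norm u) G"
      by (intro tendsto_intros id_lim)
    show "((\<lambda>z. norm (blinfun_apply (T z) u)) \<longlongrightarrow> norm (g u)) G"
      by (intro tendsto_norm lim)
    show "\<forall>\<^sub>F z in G. norm (blinfun_apply (T z) u) \<le> norm z * norm u"
    proof (rule always_eventually, rule allI)
      show "norm (blinfun_apply (T z) u) \<le> norm z * norm u" for z
        using norm_blinfun[of "T z" u] by (simp add: T_norm)
    qed
  qed
  have g_self: "g x = of_real ((norm x)\<^sup>2)"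
  proof -
    have "((\<lambda>z. blinfun_apply (T z) (z - x)) \<longlongrightarrow> 0) G"
    proof (rule Lim_null_comparison)
      show "\<forall>\<^sub>F z in G. norm (blinfun_apply (T z) (z - x)) \<le> norm z * norm (z - x)"
      proof (rule always_eventually, rule allI)
        show "norm (blinfun_apply (T z) (z - x)) \<le> norm z * norm (z - x)" for z
          using norm_blinfun[of "T z" "z - x"] by (simp add: T_norm)
      qed
      have "((\<lambda>z. norm z * norm (z - x)) \<longlongrightarrow> norm x * norm (x - x)) G"
        by (intro tendsto_intros id_lim)
      then show "((\<lambda>z. norm z * norm (z - x)) \<longlongrightarrow> 0) G"
        by simp
    qed
    moreover have "((\<lambda>z. of_real ((norm z)\<^sup>2) :: 'k) \<longlongrightarrow> of_real ((norm x)\<^sup>2)) G"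
      by (intro tendsto_intros id_lim)
    ultimately have "((\<lambda>z. of_real ((norm z)\<^sup>2) - blinfun_apply (T z) (z - x))
        \<longlongrightarrow> of_real ((norm x)\<^sup>2) - 0) G"
      by (intro tendsto_diff)
    then have "((\<lambda>z. blinfun_apply (T z) x) \<longlongrightarrow> of_real ((norm x)\<^sup>2)) G"
      by (simp add: blinfun.diff_right T_self)
    then show ?thesis
      using tendsto_unique[OF G(2) lim[of x]] by blast
  qed
  have "bounded_linear g"
    by (rule bounded_linear_intro[where K = "norm x"])
      (simp_all add: g_add g_scaleR g_bound mult.commute[of _ "norm x"])
  then obtain f where f: "blinfun_apply f = g"
    using bounded_linear_Blinfun_apply by blast
  have "norm f = norm x"
  proof (rule antisym)
    show "norm f \<le> norm x"
      by (rule norm_blinfun_bound) (simp_all add: f g_bound)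
    have "(norm x)\<^sup>2 \<le> norm f * norm x"
      using norm_blinfun[of f x] by (simp add: f g_self norm_power)
    then show "norm x \<le> norm f"
      by (cases "x = 0") (simp_all add: power2_eq_square)
  qed
  then show ?thesis
    using that[of f] by (simp add: f g_smul g_self dual_space_def)
qed

lemma continuous_dual_map_if_smooth:
  fixes smul :: "'k::{real_normed_field, heine_borel} \<Rightarrow> 'a::banach \<Rightarrow> 'a"
  assumes "smooth_space smul"
  shows "\<exists>T. dual_map smul T \<and> continuous_map euclidean (weak_star_topology smul) T"
proof -
  note ex1 = smooth_space_unique_dual_functional[OF assms]
  then have "\<forall>x. \<exists>f. f \<in> dual_space smul \<and> norm f = norm x
      \<and> blinfun_apply f x = of_real ((norm x)\<^sup>2)"
    by (intro allI ex1_implies_ex)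
  then obtain T where "\<forall>x. T x \<in> dual_space smul \<and> norm (T x) = norm x
      \<and> blinfun_apply (T x) x = of_real ((norm x)\<^sup>2)"
    by (rule choice[THEN exE])
  then have T: "dual_map smul T"
    by (simp add: dual_map_def)
  have "((\<lambda>z. blinfun_apply (T z)) \<longlongrightarrow> blinfun_apply (T x)) (at x)" for x
  proof (rule tendsto_if_unique_cluster_point)
    \<comment> \<open>Near \<open>x\<close> the norm of \<open>T z\<close> is at most \<open>norm x + 1\<close>, so one bound serves for all these \<open>z\<close>.\<close>
    show "compact {h :: 'a \<Rightarrow> 'k. \<forall>u. norm (h u) \<le> (norm x + 1) * norm u}"
      by (rule compact_pointwise_bounded_functions)
    have "\<forall>\<^sub>F z in at x. norm z < norm x + 1"
      by (rule order_tendstoD(2)[where y = "norm x"]) (auto intro: tendsto_intros)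
    then show "\<forall>\<^sub>F z in at x. blinfun_apply (T z) \<in> {h. \<forall>u. norm (h u) \<le> (norm x + 1) * norm u}"
    proof eventually_elim
      case (elim z)
      have "norm (blinfun_apply (T z) u) \<le> norm (T z) * norm u" for u
        by (rule norm_blinfun)
      also have "norm (T z) * norm u \<le> (norm x + 1) * norm u" for u
        using T elim by (intro mult_right_mono) (auto simp: dual_map_def)
      finally show ?case by simp
    qed
  next
    fix G g
    assume G: "G \<le> at x" "G \<noteq> bot" and lim: "((\<lambda>z. blinfun_apply (T z)) \<longlongrightarrow> g) G"
    have "G \<le> nhds x"
      using G(1) by (simp add: at_within_def)
    then obtain f where "f \<in> dual_space smul" "norm f = norm x"
      "blinfun_apply f x = of_real ((norm x)\<^sup>2)" "blinfun_apply f = g"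
      using cluster_point_of_dual_map[OF T _ G(2) tendsto_fun_apply[OF lim]] by blast
    then show "g = blinfun_apply (T x)"
      using ex1[of x] T unfolding dual_map_def by metis
  qed
  then have "continuous_on UNIV (\<lambda>z. blinfun_apply (T z) y)" for y
    by (auto simp: continuous_on_def intro: tendsto_fun_apply)
  then have "continuous_map euclidean (weak_star_topology smul) T"
    by (simp add: continuous_weak_star_iff[OF T])
  with T show ?thesis by blast
qed

theorem corollary3p7:
  shows
    "((\<exists>T :: 'a::banach \<Rightarrow> ('a \<Rightarrow>\<^sub>L real).
         dual_map scaleR T \<and> continuous_map euclidean (weak_star_topology scaleR) T)
       \<longleftrightarrow> smooth_space (scaleR :: real \<Rightarrow> 'a \<Rightarrow> 'a)) \<and>
     (\<forall>smul :: complex \<Rightarrow> 'a \<Rightarrow> 'a. banach_space_over smul \<longrightarrow>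
       ((\<exists>T :: 'a \<Rightarrow> ('a \<Rightarrow>\<^sub>L complex).
           dual_map smul T \<and> continuous_map euclidean (weak_star_topology smul) T)
         \<longleftrightarrow> smooth_space smul))"
proof (intro conjI allI impI iffI)
  show "smooth_space (scaleR :: real \<Rightarrow> 'a \<Rightarrow> 'a)"
    if "\<exists>T :: 'a \<Rightarrow> ('a \<Rightarrow>\<^sub>L real).
          dual_map scaleR T \<and> continuous_map euclidean (weak_star_topology scaleR) T"
    using that by (elim exE conjE) (rule real_smooth_if_continuous_dual_map)
  show "smooth_space smul"
    if "\<exists>T :: 'a \<Rightarrow> ('a \<Rightarrow>\<^sub>L complex).
          dual_map smul T \<and> continuous_map euclidean (weak_star_topology smul) T"
    for smul :: "complex \<Rightarrow> 'a \<Rightarrow> 'a"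
    using that by (elim exE conjE) (rule complex_smooth_if_continuous_dual_map)
qed (rule continuous_dual_map_if_smooth, assumption)+

end
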